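(* There is an absolute constant $\gamma>0$ such that the following holds. Let $\alpha\ge \alpha_0:=2^{1/2}3^{1/4}\pi^{-1/2}$, and let $A$ be an $\alpha$-dense set of $n$ points in general position in the plane. Then the edge set of the complete geometric graph $K_n[A]$ can be decomposed into at most $c\,n$ plane subgraphs, where $c=c(\alpha)<1$ is a constant depending only on $\alpha$ and satisfying $c(\alpha)\le 1-\gamma\,\alpha^{-12}$. Moreover, each of these plane subgraphs is either a star or a plane union of two stars.
   Context: For a finite point set $A$ in the plane with at least two points, $D(A)$ denotes the ratio of the maximum to the minimum pairwise Euclidean distance in $A$. An $n$-element point set $A$ is called $\alpha$-dense if $D(A)\le \alpha\, n^{1/2}$. A set of points is in general position if no three are collinear. The complete geometric graph $K_n[A]$ has vertex set $A$ and all $\binom{n}{2}$ straight-line segments between points of $A$ as edges. A geometric graph is plane if no two of its edges cross, where two segments cross if they do not share an endpoint and have a common interior point. A star is a graph of the form $K_{1,s}$ with $s\ge 0$. Decomposing the edge set into subgraphs means partitioning the edges into subgraphs, each of which is plane. *)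

theory Defs
  imports "HOL-Analysis.Analysis" "HOL-Library.Disjoint_Sets"
begin

type_synonym point = "real ^ 2"

definition pairwise_dists :: "point set \<Rightarrow> real set" where
  "pairwise_dists A = {dist p q | p q. p \<in> A \<and> q \<in> A \<and> p \<noteq> q}"

(* meaningful only for finite A with at least two points *)
definition dist_ratio :: "point set \<Rightarrow> real" where
  "dist_ratio A = Max (pairwise_dists A) / Min (pairwise_dists A)"

definition dense_set :: "real \<Rightarrow> point set \<Rightarrow> bool" where
  "dense_set \<alpha> A \<longleftrightarrow> finite A \<and> card A \<ge> 2 \<and> dist_ratio A \<le> \<alpha> * sqrt (real (card A))"

definition general_position :: "point set \<Rightarrow> bool" where
  "general_position A \<longleftrightarrow>
     (\<forall>p\<in>A. \<forall>q\<in>A. \<forall>r\<in>A. p \<noteq> q \<and> q \<noteq> r \<and> p \<noteq> r \<longrightarrow> \<not> collinear {p, q, r})"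

text \<open>An edge is the two-element set of its endpoints and is drawn as the straight-line segment
  between them. A subgraph of the complete geometric graph is represented by its edge set.\<close>

definition complete_edges :: "point set \<Rightarrow> point set set" where
  "complete_edges A = {{p, q} | p q. p \<in> A \<and> q \<in> A \<and> p \<noteq> q}"

definition crossing :: "point set \<Rightarrow> point set \<Rightarrow> bool" where
  "crossing e f \<longleftrightarrow> e \<inter> f = {} \<and>
     (\<exists>a b c d. e = {a, b} \<and> f = {c, d} \<and> open_segment a b \<inter> open_segment c d \<noteq> {})"

definition plane_graph :: "point set set \<Rightarrow> bool" where
  "plane_graph E \<longleftrightarrow> (\<forall>e\<in>E. \<forall>f\<in>E. \<not> crossing e f)"

text \<open>The edge set of a star with centre \<open>v\<close> and leaf set \<open>L\<close>; it is empty if there are no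
  leaves.\<close>

definition star :: "point set set \<Rightarrow> bool" where
  "star E \<longleftrightarrow> (\<exists>v L. finite L \<and> v \<notin> L \<and> E = (\<lambda>u. {v, u}) ` L)"

end

theory Submission imports Defs begin

text \<open>Suppose four disjoint \<open>k\<close>-point clusters are such that for every choice of one point from
  each, the fourth point \<open>d\<close> lies inside the triangle \<open>a b c\<close> of the other three. Then the stars
  of \<open>a, b, c, d\<close> inside the union of the clusters can be replaced by three plane double stars:
  \<open>a\<close> takes the clusters of \<open>a\<close> and \<open>b\<close>, and this is joined with the edges from \<open>d\<close> to the clusters
  of \<open>c\<close> and \<open>d\<close>; the other two arise by rotating \<open>a, b, c\<close>. Points outside the clusters get
  full stars, so \<open>n - k\<close> parts suffice.

  To find the clusters in a dense set, sort the points by the first coordinate and cut the first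
  half into many columns of equally many points. By a packing bound, a narrow column has many
  points in at least seven of a fixed number of horizontal strips, hence in three strips that are
  pairwise well separated. By pigeonhole two narrow columns that are close to each other share the
  middle strip. The low and the high cell of the left one, the middle cell of the right one, and
  the rightmost \<open>k\<close> points of the set, which are far away, are the clusters.\<close>

section \<open>Covers by double stars\<close>

text \<open>A star may be empty and the two stars may coincide, so single stars and empty graphs are
  included. All parts can then be handled uniformly.\<close>

definition double_star :: "point set set \<Rightarrow> bool" where
  "double_star E \<longleftrightarrow> (\<exists>S T. star S \<and> star T \<and> E = S \<union> T)"

lemma star_subset: "star S \<Longrightarrow> S' \<subseteq> S \<Longrightarrow> star S'"
proof -
  assume "star S" "S' \<subseteq> S"
  then obtain v L where L: "finite L" "v \<notin> L" "S' \<subseteq> (\<lambda>u. {v, u}) ` L"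
    by (auto simp: star_def)
  then obtain L' where "L' \<subseteq> L" "S' = (\<lambda>u. {v, u}) ` L'"
    by (meson subset_imageE)
  moreover from this L have "finite L'" "v \<notin> L'" by (auto intro: finite_subset)
  ultimately show "star S'"
    unfolding star_def by blast
qed

lemma double_star_subset: "double_star E \<Longrightarrow> E' \<subseteq> E \<Longrightarrow> double_star E'"
proof -
  assume "double_star E" "E' \<subseteq> E"
  then obtain S T where "star S" "star T" "E = S \<union> T"
    by (auto simp: double_star_def)
  moreover have "E' = (E' \<inter> S) \<union> (E' \<inter> T)"
    using \<open>E' \<subseteq> E\<close> \<open>E = S \<union> T\<close> by blast
  ultimately show ?thesis
    unfolding double_star_def by (meson inf_le2 star_subset)
qed

lemma plane_graph_subset: "plane_graph E \<Longrightarrow> E' \<subseteq> E \<Longrightarrow> plane_graph E'"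
  by (auto simp: plane_graph_def)

lemma star_spokes: "finite L \<Longrightarrow> v \<notin> L \<Longrightarrow> star ((\<lambda>u. {v, u}) ` L)"
  by (auto simp: star_def)

lemma crossing_commute: "crossing e f \<longleftrightarrow> crossing f e"
  unfolding crossing_def by (metis inf_commute)

text \<open>An open segment does not depend on the order of its ends, so one labelling of the
  endpoints decides the existential in \<open>crossing\<close>.\<close>

lemma crossing_doubleton:
  "crossing {a, b} {c, d} \<longleftrightarrow>
     {a, b} \<inter> {c, d} = {} \<and> open_segment a b \<inter> open_segment c d \<noteq> {}"
  unfolding crossing_def by (metis doubleton_eq_iff open_segment_commute)

lemma plane_graph_spokes: "plane_graph ((\<lambda>u. {v, u}) ` L)"
  by (auto simp: plane_graph_def crossing_def)

text \<open>The parts may overlap: both properties pass to subsets, so every edge can be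
  assigned to any one part containing it.\<close>

lemma partition_of_cover:
  assumes "finite T" "complete_edges A \<subseteq> (\<Union>t\<in>T. F t)"
    and good: "\<And>t. t \<in> T \<Longrightarrow> plane_graph (F t) \<and> double_star (F t)"
  shows "\<exists>P. partition_on (complete_edges A) P \<and> card P \<le> card T \<and>
           (\<forall>E\<in>P. plane_graph E \<and> double_star E)"
proof -
  have "\<forall>e\<in>complete_edges A. \<exists>t. t \<in> T \<and> e \<in> F t"
    using assms(2) by blast
  then obtain col where col: "\<And>e. e \<in> complete_edges A \<Longrightarrow> col e \<in> T \<and> e \<in> F (col e)"
    by metis
  define G where "G t = {e \<in> complete_edges A. col e = t}" for t
  \<comment> \<open>Colour classes that receive no edge are dropped because a partition has no empty
    block; this can only lower the count.\<close>
  define P where "P = G ` T - {{}}"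
  have "partition_on (complete_edges A) P"
  proof (rule partition_onI)
    show "\<Union>P = complete_edges A"
      using col by (auto simp: P_def G_def)
    show "disjnt p q" if "p \<in> P" "q \<in> P" "p \<noteq> q" for p q
      using that by (auto simp: P_def G_def disjnt_def)
    show "{} \<notin> P" by (simp add: P_def)
  qed
  moreover have "card P \<le> card T"
  proof -
    have "card P \<le> card (G ` T)"
      unfolding P_def using assms(1) by (intro card_mono) auto
    also have "\<dots> \<le> card T"
      using assms(1) by (rule card_image_le)
    finally show ?thesis .
  qed
  moreover have "plane_graph E \<and> double_star E" if "E \<in> P" for E
  proof -
    obtain t where "t \<in> T" "E = G t"
      using \<open>E \<in> P\<close> by (auto simp: P_def)
    moreover have "G t \<subseteq> F t"
      using col by (auto simp: G_def)
    ultimately show ?thesis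
      using good plane_graph_subset double_star_subset by blast
  qed
  ultimately show ?thesis by blast
qed

lemma star_imp_double_star: "star S \<Longrightarrow> double_star S"
  by (auto simp: double_star_def)

text \<open>Every edge has an endpoint other than \<open>v0\<close>, so the star at
  \<open>v0\<close> can be omitted. Saving this one part is enough when \<open>card A\<close> is
  small.\<close>

lemma trivial_decomposition:
  assumes "finite A" "A \<noteq> {}"
  shows "\<exists>P. partition_on (complete_edges A) P \<and> card P \<le> card A - 1 \<and>
           (\<forall>E\<in>P. plane_graph E \<and> double_star E)"
proof -
  obtain v0 where v0: "v0 \<in> A" using assms(2) by blast
  define F where "F v = (\<lambda>u. {v, u}) ` (A - {v})" for v
  have "\<exists>P. partition_on (complete_edges A) P \<and> card P \<le> card (A - {v0}) \<and>
           (\<forall>E\<in>P. plane_graph E \<and> double_star E)"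
  proof (rule partition_of_cover)
    show "complete_edges A \<subseteq> (\<Union>v\<in>A - {v0}. F v)"
    proof
      fix e assume "e \<in> complete_edges A"
      then obtain p q where pq: "e = {p, q}" "p \<in> A" "q \<in> A" "p \<noteq> q"
        by (auto simp: complete_edges_def)
      then have "e \<in> F p" "e \<in> F q"
        by (auto simp: F_def insert_commute)
      then show "e \<in> (\<Union>v\<in>A - {v0}. F v)"
        using pq by (cases "p = v0") auto
    qed
    show "plane_graph (F v) \<and> double_star (F v)" for v
      unfolding F_def using assms(1)
      by (auto intro!: plane_graph_spokes star_imp_double_star star_spokes)
  qed (use assms in auto)
  then show ?thesis using v0 assms(1) by simp
qed

section \<open>Saving one part per nested quadruple\<close>

text \<open>Twice the signed area of the triangle \<open>a b c\<close>: positive if it is traversed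
  counterclockwise.\<close>

definition orient :: "point \<Rightarrow> point \<Rightarrow> point \<Rightarrow> real" where
  "orient a b c = (b$1 - a$1) * (c$2 - a$2) - (b$2 - a$2) * (c$1 - a$1)"

text \<open>The vertices are listed counterclockwise, so \<open>d\<close> is in the interior exactly
  if it lies strictly to the left of each directed side.\<close>

definition inside :: "point \<Rightarrow> point \<Rightarrow> point \<Rightarrow> point \<Rightarrow> bool" where
  "inside a b c d \<longleftrightarrow> orient a b d > 0 \<and> orient b c d > 0 \<and> orient c a d > 0"

definition nested :: "point set \<Rightarrow> point set \<Rightarrow> point set \<Rightarrow> point set \<Rightarrow> bool" where
  "nested X Y Z W \<longleftrightarrow> (\<forall>a\<in>X. \<forall>b\<in>Y. \<forall>c\<in>Z. \<forall>d\<in>W. inside a b c d)"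

lemma inside_distinct: "inside a b c d \<Longrightarrow> distinct [a, b, c, d]"
  by (auto simp: inside_def orient_def)

lemma nested_rotate: "nested X Y Z W \<Longrightarrow> nested Y Z X W"
  by (auto simp: nested_def inside_def)

section \<open>Signed areas and separation of segments by lines\<close>

lemma orient_sum: "orient a b c = orient a b d + orient b c d + orient c a d"
  by (simp add: orient_def algebra_simps)

lemma orient_cycle: "orient a b c = orient b c a"
  by (simp add: orient_def algebra_simps)

lemma orient_swap: "orient a b c = - orient b a c"
  by (simp add: orient_def algebra_simps)

lemma orient_degenerate [simp]: "orient a a c = 0" "orient a b a = 0" "orient a b b = 0"
  by (simp_all add: orient_def)

text \<open>\<open>orient p q\<close> is affine in its third argument, so the same \<open>t\<close>
  serves every line \<open>p q\<close>.\<close>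

lemma orient_open_segment:
  assumes "x \<in> open_segment a b"
  obtains t where "0 < t" "t < 1"
    "\<And>p q. orient p q x = (1 - t) * orient p q a + t * orient p q b"
proof -
  obtain t where t: "0 < t" "t < 1" "x = (1 - t) *\<^sub>R a + t *\<^sub>R b"
    using assms by (auto simp: in_segment)
  have "orient p q x = (1 - t) * orient p q a + t * orient p q b" for p q
    by (simp add: t(3) orient_def algebra_simps)
  with t that show ?thesis by blast
qed

lemma orient_open_segment_less:
  assumes "x \<in> open_segment a b" "orient p q a < r" "orient p q b < r"
  shows "orient p q x < r"
proof -
  obtain t where t: "0 < t" "t < 1"
    "orient p q x = (1 - t) * orient p q a + t * orient p q b"
    using orient_open_segment[OF assms(1)] by metis
  have "(1 - t) * orient p q a + t * orient p q b < (1 - t) * r + t * r"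
    using t assms by (intro add_strict_mono mult_strict_left_mono) auto
  with t show ?thesis by (simp add: algebra_simps)
qed

lemma orient_open_segment_ge:
  assumes "x \<in> open_segment a b" "orient p q a \<ge> r" "orient p q b \<ge> r"
  shows "orient p q x \<ge> r"
proof -
  obtain t where t: "0 < t" "t < 1"
    "orient p q x = (1 - t) * orient p q a + t * orient p q b"
    using orient_open_segment[OF assms(1)] by metis
  have "(1 - t) * orient p q a + t * orient p q b \<ge> (1 - t) * r + t * r"
    using t assms by (intro add_mono mult_left_mono) auto
  with t show ?thesis by (simp add: algebra_simps)
qed

text \<open>A parallel to the line \<open>p q\<close> separates the segments. Strictness on one side
  suffices, which allows the separating line to contain the segment \<open>a b\<close>.\<close>

lemma open_segments_disjoint:
  assumes "orient p q a \<ge> r" "orient p q b \<ge> r" "orient p q c < r" "orient p q d < r"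
  shows "open_segment a b \<inter> open_segment c d = {}"
proof -
  have False if "x \<in> open_segment a b" "x \<in> open_segment c d" for x
    using orient_open_segment_ge[OF that(1) assms(1,2)]
      orient_open_segment_less[OF that(2) assms(3,4)] by simp
  then show ?thesis by blast
qed

text \<open>Spokes of one centre never cross, so only a spoke \<open>a u\<close> against a spoke
  \<open>d w\<close> matters. The separating line is \<open>a u\<close> if \<open>u\<close> is in
  \<open>Y\<close>, \<open>d w\<close> if \<open>u\<close> is in \<open>X\<close> and
  \<open>w\<close> in \<open>Z\<close>, and a parallel to \<open>b0 c0\<close> if \<open>u\<close>
  is in \<open>X\<close> and \<open>w\<close> in \<open>W\<close>.\<close>

lemma plane_nested_double_star:
  assumes nest: "nested X Y Z W" and a: "a \<in> X" and d: "d \<in> W"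
    and ne: "Y \<noteq> {}" "Z \<noteq> {}"
  shows "plane_graph ((\<lambda>u. {a, u}) ` (X - {a} \<union> Y) \<union> (\<lambda>u. {d, u}) ` (Z \<union> (W - {d})))"
proof -
  have ins: "orient a b d > 0 \<and> orient b c d > 0 \<and> orient c a d > 0"
    if "a \<in> X" "b \<in> Y" "c \<in> Z" "d \<in> W" for a b c d
    using nest that by (auto simp: nested_def inside_def)
  obtain b0 c0 where b0: "b0 \<in> Y" and c0: "c0 \<in> Z" using ne by blast
  have "open_segment a u \<inter> open_segment d w = {}"
    if u: "u \<in> X - {a} \<union> Y" and w: "w \<in> Z \<union> (W - {d})" for u w
  proof (cases "u \<in> Y")
    case True
    \<comment> \<open>For \<open>w\<close> in \<open>Z\<close> the triangle \<open>a u w\<close>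
      contains \<open>d\<close>, so its area is a sum of three positive ones. For \<open>w\<close>
      in \<open>W\<close> the point \<open>w\<close> itself is interior to
      \<open>a u c0\<close>.\<close>
    have "orient a u w > 0"
    proof (cases "w \<in> Z")
      case True
      then show ?thesis
        using orient_sum[of a u w d] ins[OF a \<open>u \<in> Y\<close> True d] by linarith
    next
      case False
      then show ?thesis using ins[OF a \<open>u \<in> Y\<close> c0, of w] w by auto
    qed
    moreover have "orient a u d > 0" using ins[OF a True c0 d] by blast
    ultimately show ?thesis
      by (intro open_segments_disjoint[of 0 u a]) (simp_all add: orient_swap[of u a])
  next
    case False
    then have u: "u \<in> X" using u by auto
    show ?thesis
    proof (cases "w \<in> Z")
      case True
      \<comment> \<open>\<open>d\<close> lies to the left of the side from \<open>w\<close> to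
        \<open>a\<close>, and of the side from \<open>w\<close> to \<open>u\<close>. Cyclic symmetry
        puts \<open>a\<close> and \<open>u\<close> on one side of the line
        \<open>d w\<close>.\<close>
      have "orient d w a > 0" "orient d w u > 0"
        using ins[OF a b0 True d] ins[OF u b0 True d] by (metis orient_cycle)+
      then have "open_segment a u \<inter> open_segment d w = {}"
        using orient_open_segment_less[where p = w and q = d and r = 0 and a = a and b = u]
          orient_open_segment_ge[where p = w and q = d and r = 0 and a = d and b = w]
        by (force simp: orient_swap[of w d])
      then show ?thesis .
    next
      case False
      then have w: "w \<in> W" using w by auto
      \<comment> \<open>Both endpoints of \<open>a u\<close> are farther from the line \<open>b0 c0\<close> than both endpoints of \<open>d w\<close>.\<close>
      define r where "r = min (orient b0 c0 a) (orient b0 c0 u)"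
      have lt: "orient b0 c0 e < orient b0 c0 f" if "e \<in> W" "f \<in> X" for e f
        using ins[OF that(2) b0 c0 that(1)] orient_sum[of b0 c0 f e]
          orient_cycle[of f b0 c0] by (auto simp: orient_cycle)
      show ?thesis
        by (rule open_segments_disjoint[of r b0 c0])
          (use lt a u d w in \<open>auto simp: r_def\<close>)
    qed
  qed
  then have "\<not> crossing {a, u} {d, w}" "\<not> crossing {d, w} {a, u}"
    if "u \<in> X - {a} \<union> Y" "w \<in> Z \<union> (W - {d})" for u w
    using that by (simp_all add: crossing_doubleton Int_commute)
  moreover have "\<not> crossing {v, u} {v, w}" for v u w
    by (simp add: crossing_doubleton)
  ultimately show ?thesis
    unfolding plane_graph_def ball_Un ball_simps by (intro conjI ballI) simp_all
qed

lemma nested_disjoint: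
  assumes "nested X Y Z W" "X \<noteq> {}" "Y \<noteq> {}" "Z \<noteq> {}" "W \<noteq> {}"
  shows "X \<inter> Y = {}" "X \<inter> Z = {}" "X \<inter> W = {}" "Y \<inter> Z = {}" "Y \<inter> W = {}" "Z \<inter> W = {}"
proof -
  have ds: "distinct [a, b, c, d]" if "a \<in> X" "b \<in> Y" "c \<in> Z" "d \<in> W" for a b c d
    using assms(1) that inside_distinct unfolding nested_def by blast
  obtain a0 b0 c0 d0 where a0: "a0 \<in> X" and b0: "b0 \<in> Y" and c0: "c0 \<in> Z" and d0: "d0 \<in> W"
    using assms(2-) by blast
  show "X \<inter> Y = {}" "X \<inter> Z = {}" "X \<inter> W = {}" "Y \<inter> Z = {}" "Y \<inter> W = {}" "Z \<inter> W = {}"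
    using ds[OF _ _ c0 d0] ds[OF _ b0 _ d0] ds[OF _ b0 c0] ds[OF a0 _ _ d0] ds[OF a0 _ c0]
      ds[OF a0 b0] by fastforce+
qed

text \<open>Matching the clusters arbitrarily into \<open>k\<close> quadruples gives
  \<open>3 * k\<close> double stars instead of \<open>4 * k\<close> stars. The centre in
  \<open>W\<close> occurs in three of them, where its spokes reach \<open>Z\<close>,
  \<open>X\<close> and \<open>Y\<close> in turn, and \<open>W\<close> each time.\<close>

lemma nested_decomposition:
  assumes fin: "finite A" and sub: "X \<subseteq> A" "Y \<subseteq> A" "Z \<subseteq> A" "W \<subseteq> A"
    and nest: "nested X Y Z W"
    and card: "card X = k" "card Y = k" "card Z = k" "card W = k" and k: "k > 0"
  shows "\<exists>P. partition_on (complete_edges A) P \<and> card P \<le> card A - k \<and>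
           (\<forall>E\<in>P. plane_graph E \<and> double_star E)"
proof -
  have finS: "finite X" "finite Y" "finite Z" "finite W"
    using fin sub finite_subset by blast+
  have ne: "X \<noteq> {}" "Y \<noteq> {}" "Z \<noteq> {}" "W \<noteq> {}" using card k by auto
  note dj = nested_disjoint[OF nest ne]
  define R where "R = A - (X \<union> Y \<union> Z \<union> W)"
  define star_at where "star_at v = (\<lambda>u. {v, u}) ` (A - {v})" for v :: point
  define dbl where "dbl S S' T a d =
      (\<lambda>u. {a, u}) ` (S - {a} \<union> S') \<union> (\<lambda>u. {d, u}) ` (T \<union> (W - {d}))"
    for S S' T :: "point set" and a d :: point
  have "\<exists>f. bij_betw f {..<k} S" if "finite S" "card S = k" for S :: "point set"
    using that by (metis bij_betw_from_nat_into_finite)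
  then obtain fx fy fz fw where f: "bij_betw fx {..<k} X" "bij_betw fy {..<k} Y"
      "bij_betw fz {..<k} Z" "bij_betw fw {..<k} W"
    using finS card by (metis (lifting))
  have mem: "fx i \<in> X" "fy i \<in> Y" "fz i \<in> Z" "fw i \<in> W" if "i < k" for i
    using f that by (auto simp: bij_betw_def)
  have surj: "p \<in> X \<Longrightarrow> \<exists>i<k. fx i = p" "p \<in> Y \<Longrightarrow> \<exists>i<k. fy i = p"
    "p \<in> Z \<Longrightarrow> \<exists>i<k. fz i = p" "p \<in> W \<Longrightarrow> \<exists>i<k. fw i = p" for p
    using f by (auto simp: bij_betw_def)
  \<comment> \<open>The index type is a disjoint sum: points outside the clusters, then one copy of
    \<open>{..<k}\<close> for each rotation of \<open>X\<close>, \<open>Y\<close>, \<open>Z\<close>.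
    The number of parts is then a plain sum.\<close>
  define F where "F = (\<lambda>t :: point + nat + nat + nat. case t of
      Inl v \<Rightarrow> star_at v
    | Inr (Inl i) \<Rightarrow> dbl X Y Z (fx i) (fw i)
    | Inr (Inr (Inl i)) \<Rightarrow> dbl Y Z X (fy i) (fw i)
    | Inr (Inr (Inr i)) \<Rightarrow> dbl Z X Y (fz i) (fw i))"
  define T where "T = R <+> {..<k} <+> {..<k} <+> {..<k}"
  have finR: "finite R" using fin by (simp add: R_def)
  have "card (X \<union> Y \<union> Z \<union> W) = 4 * k"
    using finS dj card by (simp add: card_Un_disjoint Int_Un_distrib2)
  then have "card R = card A - 4 * k" "4 * k \<le> card A"
    using sub fin card_mono[of A "X \<union> Y \<union> Z \<union> W"]
    by (auto simp: R_def card_Diff_subset finS)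
  then have cT: "card T = card A - k"
    using finR by (simp add: T_def card_Plus)
  have dbl_good: "plane_graph (dbl S S' T' a d) \<and> double_star (dbl S S' T' a d)"
    if "nested S S' T' W" "S \<inter> S' = {}" "T' \<inter> W = {}" "S' \<noteq> {}" "T' \<noteq> {}"
      "finite S" "finite S'" "finite T'" "a \<in> S" "d \<in> W" for S S' T' a d
  proof
    show "plane_graph (dbl S S' T' a d)"
      unfolding dbl_def using that by (intro plane_nested_double_star) auto
    have "star ((\<lambda>u. {a, u}) ` (S - {a} \<union> S'))"
      using that by (intro star_spokes) auto
    moreover have "star ((\<lambda>u. {d, u}) ` (T' \<union> (W - {d})))"
      using that finS by (intro star_spokes) auto
    ultimately show "double_star (dbl S S' T' a d)"
      unfolding double_star_def dbl_def by blast
  qed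
  note nest2 = nested_rotate[OF nest]
  note nest3 = nested_rotate[OF nest2]
  have "\<exists>P. partition_on (complete_edges A) P \<and> card P \<le> card T \<and>
           (\<forall>E\<in>P. plane_graph E \<and> double_star E)"
  proof (rule partition_of_cover)
    show "finite T" using finR by (simp add: T_def)
    show "plane_graph (F t) \<and> double_star (F t)" if t: "t \<in> T" for t
    proof -
      have "plane_graph (star_at v) \<and> double_star (star_at v)" for v
        unfolding star_at_def using fin
        by (auto intro!: plane_graph_spokes star_imp_double_star star_spokes)
      moreover have "plane_graph (dbl X Y Z (fx i) (fw i)) \<and> double_star (dbl X Y Z (fx i) (fw i))"
        "plane_graph (dbl Y Z X (fy i) (fw i)) \<and> double_star (dbl Y Z X (fy i) (fw i))"
        "plane_graph (dbl Z X Y (fz i) (fw i)) \<and> double_star (dbl Z X Y (fz i) (fw i))"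
        if "i < k" for i
        using that dbl_good[OF nest dj(1,6) ne(2,3) finS(1-3) mem(1,4)]
          dbl_good[OF nest2 dj(4,3) ne(3,1) finS(2,3,1) mem(2,4)]
          dbl_good[OF nest3 _ dj(5) ne(1,2) finS(3,1,2) mem(3,4)] dj(2)
        by (simp_all add: Int_commute)
      ultimately show ?thesis using t by (auto simp: T_def F_def)
    qed
    show "complete_edges A \<subseteq> (\<Union>t\<in>T. F t)"
    proof
      fix e assume "e \<in> complete_edges A"
      then obtain p q where e: "e = {p, q}" and pq: "p \<in> A" "q \<in> A" "p \<noteq> q"
        by (auto simp: complete_edges_def)
      have FX: "dbl X Y Z (fx i) (fw i) \<subseteq> (\<Union>t\<in>T. F t)"
        "dbl Y Z X (fy i) (fw i) \<subseteq> (\<Union>t\<in>T. F t)"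
        "dbl Z X Y (fz i) (fw i) \<subseteq> (\<Union>t\<in>T. F t)" if "i < k" for i
        using that by (force simp: T_def F_def)+
      have spoke1: "{a, u} \<in> dbl S S' T' a d" if "u \<in> S \<union> S'" "a \<noteq> u" for a u S S' T' d
        using that by (auto simp: dbl_def)
      have spoke2: "{d, u} \<in> dbl S S' T' a d" if "u \<in> T' \<union> (W - {d})" for a u S S' T' d
        using that by (auto simp: dbl_def)
      \<comment> \<open>The cases list which endpoint's star takes the edge. Every edge falls under
        one of them after possibly swapping \<open>p\<close> and \<open>q\<close>.\<close>
      have cov: "{p, q} \<in> (\<Union>t\<in>T. F t)" if pq: "p \<in> A" "q \<in> A" "p \<noteq> q"
        and c: "p \<in> R \<or> p \<in> X \<and> q \<in> X \<union> Y \<or> p \<in> Y \<and> q \<in> Y \<union> Z \<or> p \<in> Z \<and> q \<in> Z \<union> X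
          \<or> p \<in> W \<and> q \<in> X \<union> Y \<union> Z \<union> W" for p q
        using c
      proof (elim disjE conjE)
        assume "p \<in> R"
        then have "{p, q} \<in> F (Inl p)" "Inl p \<in> T"
          using pq by (auto simp: F_def T_def star_at_def)
        then show ?thesis by blast
      next
        assume *: "p \<in> X" "q \<in> X \<union> Y"
        then obtain i where i: "i < k" "fx i = p" using surj by blast
        show ?thesis using spoke1[OF *(2) pq(3)] FX(1)[OF i(1)] unfolding i(2) by blast
      next
        assume *: "p \<in> Y" "q \<in> Y \<union> Z"
        then obtain i where i: "i < k" "fy i = p" using surj by blast
        show ?thesis using spoke1[OF *(2) pq(3)] FX(2)[OF i(1)] unfolding i(2) by blast
      next
        assume *: "p \<in> Z" "q \<in> Z \<union> X"
        then obtain i where i: "i < k" "fz i = p" using surj by blast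
        show ?thesis using spoke1[OF *(2) pq(3)] FX(3)[OF i(1)] unfolding i(2) by blast
      next
        assume *: "p \<in> W" "q \<in> X \<union> Y \<union> Z \<union> W"
        then obtain i where i: "i < k" "fw i = p" using surj by blast
        from * have "q \<in> Z \<union> (W - {p}) \<or> q \<in> X \<or> q \<in> Y" using pq by blast
        then show ?thesis
          using spoke2[of q _ p] FX[OF i(1)] unfolding i(2) by blast
      qed
      have "p \<in> R \<union> X \<union> Y \<union> Z \<union> W" "q \<in> R \<union> X \<union> Y \<union> Z \<union> W"
        using pq by (auto simp: R_def)
      then have "{p, q} \<in> (\<Union>t\<in>T. F t) \<or> {q, p} \<in> (\<Union>t\<in>T. F t)"
        using cov[OF pq] cov[OF pq(2,1) pq(3)[symmetric]] by blast
      then show "e \<in> (\<Union>t\<in>T. F t)" by (simp add: e insert_commute)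
    qed
  qed
  then show ?thesis by (simp add: cT)
qed

section \<open>Separated sets in boxes\<close>

lemma floor_div_eq_imp_diff_less:
  fixes x y d :: real
  assumes "\<lfloor>x / d\<rfloor> = \<lfloor>y / d\<rfloor>" "d > 0"
  shows "\<bar>x - y\<bar> < d"
proof -
  have "\<bar>x / d - y / d\<bar> < 1" using assms(1) by linarith
  then have "\<bar>(x - y) / d\<bar> < 1" by (simp add: diff_divide_distrib)
  then show ?thesis using assms(2) by (simp add: abs_divide)
qed

text \<open>In a grid of mesh \<open>\<delta>/2\<close>, two points of one square are at distance
  less than \<open>\<delta>\<close>, so each square holds at most one point of
  \<open>S\<close>.\<close>

lemma card_separated_le:
  fixes S :: "point set"
  assumes sep: "\<And>p q. p \<in> S \<Longrightarrow> q \<in> S \<Longrightarrow> p \<noteq> q \<Longrightarrow> \<delta> \<le> dist p q" and "\<delta> > 0"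
    and box: "\<And>p. p \<in> S \<Longrightarrow> x0 \<le> p$1 \<and> p$1 \<le> x0 + w \<and> y0 \<le> p$2 \<and> p$2 \<le> y0 + h"
    and "w \<ge> 0" "h \<ge> 0"
  shows "real (card S) \<le> (2 * w / \<delta> + 1) * (2 * h / \<delta> + 1)"
proof -
  define f where "f p = (\<lfloor>(p$1 - x0) / (\<delta>/2)\<rfloor>, \<lfloor>(p$2 - y0) / (\<delta>/2)\<rfloor>)" for p :: point
  define G where "G = {0..\<lfloor>2 * w / \<delta>\<rfloor>} \<times> {0..\<lfloor>2 * h / \<delta>\<rfloor>}"
  have inj: "inj_on f S"
  proof (rule inj_onI, rule ccontr)
    fix p q assume pq: "p \<in> S" "q \<in> S" "f p = f q" "p \<noteq> q"
    have "\<bar>(p$1 - x0) - (q$1 - x0)\<bar> < \<delta>/2" "\<bar>(p$2 - y0) - (q$2 - y0)\<bar> < \<delta>/2"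
      by (rule floor_div_eq_imp_diff_less; use pq(3) \<open>\<delta> > 0\<close> in \<open>simp add: f_def\<close>)+
    moreover have "dist p q \<le> \<bar>p$1 - q$1\<bar> + \<bar>p$2 - q$2\<bar>"
      using norm_le_l1_cart[of "p - q"] by (simp add: dist_norm UNIV_2)
    ultimately show False using sep[OF pq(1,2,4)] by simp
  qed
  have sub: "f ` S \<subseteq> G"
  proof
    fix z assume "z \<in> f ` S"
    then obtain p where p: "p \<in> S" "z = f p" by blast
    show "z \<in> G"
      using box[OF p(1)] \<open>\<delta> > 0\<close>
      by (auto simp: p(2) f_def G_def field_simps intro!: floor_mono divide_right_mono)
  qed
  have "finite G" by (simp add: G_def)
  then have "card S \<le> card G"
    using inj sub by (metis card_image card_mono)
  then have "real (card S) \<le> real (card G)" by simp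
  also have "\<dots> = real_of_int (\<lfloor>2 * w / \<delta>\<rfloor> + 1) * real_of_int (\<lfloor>2 * h / \<delta>\<rfloor> + 1)"
    using assms by (simp add: G_def card_cartesian_product)
  also have "\<dots> \<le> (2 * w / \<delta> + 1) * (2 * h / \<delta> + 1)"
    using assms by (intro mult_mono) auto
  finally show ?thesis .
qed

text \<open>Once both sides are at least \<open>\<delta>\<close>, each summand 1 is absorbed into
  the factor 3.\<close>

lemma card_separated_le_area:
  fixes S :: "point set"
  assumes sep: "\<And>p q. p \<in> S \<Longrightarrow> q \<in> S \<Longrightarrow> p \<noteq> q \<Longrightarrow> \<delta> \<le> dist p q" and "\<delta> > 0"
    and box: "\<And>p. p \<in> S \<Longrightarrow> x0 \<le> p$1 \<and> p$1 \<le> x0 + w \<and> y0 \<le> p$2 \<and> p$2 \<le> y0 + h"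
    and "w \<ge> \<delta>" "h \<ge> \<delta>"
  shows "real (card S) \<le> 9 * w * h / \<delta>^2"
proof -
  have "real (card S) \<le> (2 * w / \<delta> + 1) * (2 * h / \<delta> + 1)"
    using assms by (intro card_separated_le[of S \<delta> x0 w y0 h]) auto
  also have "\<dots> \<le> (3 * w / \<delta>) * (3 * h / \<delta>)"
    using assms by (intro mult_mono) (auto simp: field_simps)
  finally show ?thesis by (simp add: power2_eq_square)
qed

section \<open>Nested quadruples of clusters in dense sets\<close>

text \<open>Greedy choice: taking the minimum discards at most three values, and 7 - 3 - 3 leaves
  one.\<close>

lemma three_spread_elements:
  fixes S :: "nat set"
  assumes "finite S" "card S \<ge> 7"
  obtains a b c where "a \<in> S" "b \<in> S" "c \<in> S" "a + 3 \<le> b" "b + 3 \<le> c"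
proof -
  have step: "\<exists>a\<in>S. \<exists>T\<subseteq>S. card T + 3 \<ge> card S \<and> (\<forall>t\<in>T. a + 3 \<le> t)"
    if "finite S" "S \<noteq> {}" for S :: "nat set"
  proof (intro bexI exI conjI)
    have "card S - card {Min S..<Min S + 3} \<le> card (S - {Min S..<Min S + 3})"
      by (rule diff_card_le_card_Diff) simp
    then show "card S \<le> card (S - {Min S..<Min S + 3}) + 3" by simp
    show "\<forall>t\<in>S - {Min S..<Min S + 3}. Min S + 3 \<le> t"
      using that by (auto simp: not_less)
  qed (use that in auto)
  obtain a T where a: "a \<in> S" "T \<subseteq> S" "card T + 3 \<ge> card S" "\<forall>t\<in>T. a + 3 \<le> t"
    using step[of S] assms by force
  moreover obtain b U where "b \<in> T" "U \<subseteq> T" "card U + 3 \<ge> card T" "\<forall>t\<in>U. b + 3 \<le> t"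
    using step[of T] a assms finite_subset[OF a(2)] by force
  moreover have "U \<noteq> {}"
    using calculation assms by force
  ultimately show ?thesis using that by blast
qed

lemma ex_mono_enumeration:
  fixes A :: "'a set" and f :: "'a \<Rightarrow> 'b::linorder"
  assumes "finite A"
  obtains h where "bij_betw h {..<card A} A"
    "\<And>i j. i \<le> j \<Longrightarrow> j < card A \<Longrightarrow> f (h i) \<le> f (h j)"
proof -
  obtain xs where xs: "set xs = A" "distinct xs"
    using assms finite_distinct_list by blast
  define ys where "ys = sort_key f xs"
  have ys: "set ys = A" "distinct ys" "length ys = card A"
    using xs by (auto simp: ys_def distinct_card)
  have "sorted (map f ys)" by (simp add: ys_def)
  then have "f (ys ! i) \<le> f (ys ! j)" if "i \<le> j" "j < card A" for i j
    using that ys by (auto simp: sorted_iff_nth_mono)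
  moreover have "bij_betw ((!) ys) {..<card A} A"
    using ys by (intro bij_betw_nth) auto
  ultimately show ?thesis using that by blast
qed

section \<open>Recognising an interior point from coordinates\<close>

lemma collinear_if_orient_0:
  assumes "orient p q r = 0"
  shows "collinear {p, q, r}"
proof (cases "p = q")
  case True
  then show ?thesis by (simp add: collinear_2)
next
  case False
  have *: "(q$1 - p$1) * (r$2 - p$2) = (q$2 - p$2) * (r$1 - p$1)"
    using assms by (simp add: orient_def)
  have "\<exists>c. r - p = c *\<^sub>R (q - p)"
  proof (cases "q$1 = p$1")
    case True
    then have "q$2 \<noteq> p$2" using False by (simp add: vec_eq_iff forall_2)
    then show ?thesis using * True
      by (intro exI[of _ "(r$2 - p$2) / (q$2 - p$2)"]) (auto simp: vec_eq_iff forall_2)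
  next
    case F: False
    then have "(r$1 - p$1) / (q$1 - p$1) * (q$2 - p$2) = r$2 - p$2"
      using * by (simp add: divide_eq_eq mult.commute)
    then show ?thesis using F
      by (intro exI[of _ "(r$1 - p$1) / (q$1 - p$1)"]) (simp add: vec_eq_iff forall_2)
  qed
  then obtain c where "r - p = c *\<^sub>R (q - p)" by blast
  then have "r = (1 - c) *\<^sub>R p + (1 - (1 - c)) *\<^sub>R q"
    by (simp add: algebra_simps)
  then have "collinear {p, r, q}"
    unfolding collinear_3_expand by blast
  then show ?thesis by (simp add: insert_commute)
qed

text \<open>On the way from \<open>l\<close> or \<open>u\<close> to the far point \<open>c\<close>, the line has moved vertically by at most
  \<open>2 * g\<close> when it passes \<open>m\<close>. General position turns the weak inequalities between first
  coordinates, which cannot exclude ties, into a strict orientation.\<close>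

lemma inside_of_columns:
  assumes gp: "\<not> collinear {u, l, m}"
    and y: "m$2 + 2 * g < u$2" "l$2 + 2 * g < m$2" "g > 0"
    and x: "l$1 \<le> m$1" "u$1 \<le> m$1" "m$1 \<le> l$1 + 2 * \<omega>" "m$1 \<le> u$1 + 2 * \<omega>"
    and far: "c$1 \<ge> l$1 + \<Delta>" "c$1 \<ge> u$1 + \<Delta>" "\<Delta> > 0"
    and E: "\<bar>c$2 - u$2\<bar> \<le> E" "\<bar>c$2 - l$2\<bar> \<le> E"
    and slope: "E * \<omega> \<le> g * \<Delta>"
  shows "inside l c u m"
proof -
  have w: "0 \<le> \<omega>" using x by linarith
  have E0: "0 \<le> E" using E by linarith
  \<comment> \<open>The common slope estimate: a line rising at most \<open>E\<close> over a run of
    at least \<open>\<Delta>\<close> changes height by at most \<open>2 * g\<close> within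
    horizontal distance \<open>2 * \<omega>\<close>, while the vertical margin \<open>v\<close>
    exceeds that.\<close>
  have key: "b * t < v * a" if "a \<ge> \<Delta>" "v > 2 * g" "0 \<le> t" "t \<le> 2 * \<omega>" "b \<le> E" for a v t b :: real
  proof -
    have "b * t \<le> E * t" using that by (intro mult_right_mono)
    also have "\<dots> \<le> E * (2 * \<omega>)" using that E0 by (intro mult_left_mono)
    also have "\<dots> \<le> (2 * g) * \<Delta>" using slope by simp
    also have "\<dots> < v * \<Delta>" using that far by simp
    also have "\<dots> \<le> v * a" using that y by (intro mult_left_mono) auto
    finally show ?thesis .
  qed
  have "orient l c m > 0"
    using key[of "c$1 - l$1" "m$2 - l$2" "m$1 - l$1" "c$2 - l$2"] x y far E
    by (simp add: orient_def mult.commute)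
  moreover have "orient c u m > 0"
  proof -
    have "(u$2 - c$2) * (m$1 - u$1) < (u$2 - m$2) * (c$1 - u$1)"
      using key[of "c$1 - u$1" "u$2 - m$2" "m$1 - u$1" "u$2 - c$2"] x y far E by simp
    then show ?thesis by (simp add: orient_def algebra_simps)
  qed
  moreover have "orient u l m > 0"
  proof -
    have "orient u l m = (u$2 - m$2) * (m$1 - l$1) + (m$2 - l$2) * (m$1 - u$1)"
      by (simp add: orient_def algebra_simps)
    moreover have "(u$2 - m$2) * (m$1 - l$1) \<ge> 0" "(m$2 - l$2) * (m$1 - u$1) \<ge> 0"
      using x y by (intro mult_nonneg_nonneg; simp)+
    moreover have "orient u l m \<noteq> 0" using gp collinear_if_orient_0 by blast
    ultimately show ?thesis by linarith
  qed
  ultimately show ?thesis by (simp add: inside_def)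
qed

section \<open>Existence of the clusters\<close>

lemma component_diff_le_dist: "\<bar>p$i - q$i\<bar> \<le> dist p (q :: real ^ 'n)"
  by (metis component_le_norm_cart dist_norm vector_minus_component)

text \<open>\<open>I\<close> columns of \<open>N\<close> points cover at most half of the set,
  \<open>J\<close> counts strips, \<open>V\<close> counts windows for the column positions, and
  \<open>K\<close> is the cluster size. \<open>fat\<close> and \<open>colB\<close> yield seven
  well-filled cells in a narrow column, \<open>pig\<close> two narrow columns with matching data,
  and \<open>gap\<close> the distance to the far cluster.\<close>

lemma clusters_exist:
  fixes A :: "point set" and E \<delta> :: real and I J V N K :: nat
  defines "n \<equiv> card A"
  assumes fin: "finite A" and gp: "general_position A"
    and sep: "\<And>p q. p \<in> A \<Longrightarrow> q \<in> A \<Longrightarrow> p \<noteq> q \<Longrightarrow> \<delta> \<le> dist p q"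
    and diam: "\<And>p q. p \<in> A \<Longrightarrow> q \<in> A \<Longrightarrow> dist p q \<le> E"
    and \<delta>: "\<delta> > 0" and pos: "J > 0" "V > 0" "K > 0" "N > 0"
    and IN: "2 * I * N \<le> n" and K4: "4 * K \<le> n" and fat: "2 * K * (J + 1) \<le> N"
    and colB: "12 * (9 * (2 * E / I) * (E / J) / \<delta>^2) < N"
    and \<tau>: "2 * E / I \<ge> \<delta>" "I \<ge> 2 * V" "I \<ge> 2 * J"
    and gap: "9 * (J * E / V) * E / \<delta>^2 < n / 4" "J * E / V \<ge> \<delta>"
    and pig: "2 * (J + 1) * (V + 1) < I"
  shows "\<exists>X Y Z W. X \<subseteq> A \<and> Y \<subseteq> A \<and> Z \<subseteq> A \<and> W \<subseteq> A \<and> nested X Y Z W \<and>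
           card X = K \<and> card Y = K \<and> card Z = K \<and> card W = K"
proof -
  have I0: "I > 0" using \<tau> pos by auto
  have n0: "n > 0" using pos K4 by auto
  then have "A \<noteq> {}" by (auto simp: n_def)
  have E\<delta>: "E \<ge> \<delta>"
  proof -
    have E0: "E \<ge> 0" using diam[of "SOME x. x \<in> A" "SOME x. x \<in> A"] \<open>A \<noteq> {}\<close>
      by (simp add: some_in_eq)
    have "2 * E / I \<le> E / 1"
      using E0 \<tau>(2) pos by (simp add: field_simps mult_left_mono)
    then show ?thesis using \<tau> by simp
  qed
  then have E0: "E > 0" using \<delta> by simp
  \<comment> \<open>Strip height, window width, twice the bound \<open>E / I\<close> on the average
    column width, and distance to the far cluster. \<open>\<Delta>\<close> is chosen so that
    \<open>g * \<Delta> = E * \<omega>\<close>.\<close>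
  define g \<omega> \<tau>0 \<Delta> where "g = E / J" and "\<omega> = E / V" and "\<tau>0 = 2 * E / I" and "\<Delta> = J * E / V"
  have pos2: "g > 0" "\<omega> > 0" "\<tau>0 > 0" "\<Delta> > 0"
    using E0 pos I0 by (auto simp: g_def \<omega>_def \<tau>0_def \<Delta>_def)
  have \<tau>\<omega>: "\<tau>0 \<le> \<omega>"
  proof -
    have "2 * real V \<le> real I" using \<tau>(2) by linarith
    then have "2 * E / I \<le> 2 * E / (2 * real V)"
      using E0 pos I0 by (intro divide_left_mono) auto
    then show ?thesis by (simp add: \<tau>0_def \<omega>_def)
  qed
  have \<tau>g: "\<tau>0 \<le> g"
  proof -
    have "2 * real J \<le> real I" using \<tau>(3) by linarith
    then have "2 * E / I \<le> 2 * E / (2 * real J)"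
      using E0 pos I0 by (intro divide_left_mono) auto
    then show ?thesis by (simp add: \<tau>0_def g_def)
  qed
  have slope: "E * \<omega> \<le> g * \<Delta>" using pos by (simp add: g_def \<omega>_def \<Delta>_def)
  obtain h where h: "bij_betw h {..<n} A"
    and hm: "\<And>i j. i \<le> j \<Longrightarrow> j < n \<Longrightarrow> h i $ 1 \<le> h j $ 1"
    using ex_mono_enumeration[OF fin, of "\<lambda>p. p $ 1"] unfolding n_def by metis
  define X where "X i = h i $ 1" for i
  have hA: "h i \<in> A" if "i < n" for i using h that by (auto simp: bij_betw_def)
  have inj: "inj_on h {..<n}" using h by (simp add: bij_betw_def)
  have Xm: "X i \<le> X j" if "i \<le> j" "j < n" for i j using hm that by (simp add: X_def)
  obtain ymin where ymin: "ymin \<in> A" "\<And>p. p \<in> A \<Longrightarrow> ymin $ 2 \<le> p $ 2"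
    using that[OF arg_min_if_finite(1)[OF fin \<open>A \<noteq> {}\<close>]
        arg_min_least[OF fin \<open>A \<noteq> {}\<close>]] by blast
  define x0 y0 where "x0 = X 0" and "y0 = ymin $ 2"
  have yb: "y0 \<le> p $ 2 \<and> p $ 2 \<le> y0 + E" if "p \<in> A" for p
    using ymin(2)[OF that] component_diff_le_dist[of p 2 ymin] diam[OF that ymin(1)]
    by (auto simp: y0_def)
  have XE: "X i \<le> x0 + E" if "i < n" for i
    using component_diff_le_dist[of "h i" 1 "h 0"] diam[OF hA[OF that] hA[of 0]] n0
    by (auto simp: x0_def X_def)
  have INn: "I * N < n"
  proof -
    have "0 < I * N" using I0 pos by simp
    moreover have "2 * (I * N) \<le> n" using IN by (simp add: mult.assoc)
    ultimately show ?thesis by linarith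
  qed
  \<comment> \<open>The case \<open>j = N\<close> supplies a right boundary point even for the last
    column.\<close>
  have idx: "i * N + j < n" if "i < I" "j \<le> N" for i j
  proof -
    have "i * N + j \<le> (i + 1) * N" using that by simp
    also have "\<dots> \<le> I * N" using that by (intro mult_right_mono) auto
    finally have "i * N + j \<le> I * N" .
    with INn show ?thesis by simp
  qed
  define col where "col i = h ` {i * N..<(i + 1) * N}" for i
  have col_card: "card (col i) = N" and colA: "col i \<subseteq> A" if "i < I" for i
  proof -
    have sub: "{i * N..<(i + 1) * N} \<subseteq> {..<n}"
      using idx[OF that, of N] by auto
    then show "col i \<subseteq> A" using hA by (auto simp: col_def)
    show "card (col i) = N"
      unfolding col_def using inj sub by (subst card_image) (auto intro: inj_on_subset)
  qed
  have colx: "X (i * N) \<le> p $ 1 \<and> p $ 1 \<le> X ((i + 1) * N)" if "i < I" "p \<in> col i" for i p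
  proof -
    obtain k where "p = h k" "i * N \<le> k" "k < (i + 1) * N"
      using \<open>p \<in> col i\<close> by (auto simp: col_def)
    then show ?thesis using Xm[of "i * N" k] Xm[of k "(i+1) * N"] idx[OF that(1), of N]
      by (auto simp: X_def add.commute)
  qed
  define narrow where "narrow = {i\<in>{..<I}. X ((i + 1) * N) - X (i * N) \<le> \<tau>0}"
  \<comment> \<open>The column widths telescope to at most \<open>E\<close>, so at most half of the
    columns can be wider than \<open>2 * E / I\<close>.\<close>
  have narrow_card: "I \<le> 2 * card narrow"
  proof -
    define wide where "wide = {..<I} - narrow"
    have "(\<Sum>i<I. X ((i + 1) * N) - X (i * N)) = X (I * N) - X 0"
      using sum_lessThan_telescope[of "\<lambda>i. X (i * N)" I] by simp
    also have "\<dots> \<le> E" using XE[OF INn] by (simp add: x0_def)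
    finally have tot: "(\<Sum>i<I. X ((i + 1) * N) - X (i * N)) \<le> E" .
    have "card wide * \<tau>0 \<le> (\<Sum>i\<in>wide. X ((i + 1) * N) - X (i * N))"
      by (rule sum_bounded_below) (auto simp: wide_def narrow_def)
    also have "\<dots> \<le> (\<Sum>i<I. X ((i + 1) * N) - X (i * N))"
    proof (rule sum_mono2)
      fix b assume "b \<in> {..<I} - wide"
      then show "0 \<le> X ((b + 1) * N) - X (b * N)"
        using Xm[of "b * N" "(b + 1) * N"] idx[of b N] by (auto simp: add.commute)
    qed (auto simp: wide_def)
    finally have "card wide * \<tau>0 \<le> E" using tot by simp
    then have "real (card wide) * 2 \<le> I"
      using E0 I0 by (simp add: \<tau>0_def field_simps)
    moreover have "narrow \<subseteq> {..<I}" by (auto simp: narrow_def)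
    then have "card wide = I - card narrow" "card narrow \<le> I"
      using card_mono[of "{..<I}" narrow] finite_subset[of narrow "{..<I}"]
      by (simp_all add: wide_def card_Diff_subset)
    ultimately show ?thesis by linarith
  qed
  \<comment> \<open>A point at height exactly \<open>y0 + E\<close> is in row \<open>J\<close>, so
    there are \<open>J + 1\<close> rows.\<close>
  define row where "row p = nat \<lfloor>(p $ 2 - y0) / g\<rfloor>" for p :: point
  have row_le: "row p \<le> J" if "p \<in> A" for p
  proof -
    have "p $ 2 - y0 \<le> J * g"
      using yb[OF that] pos by (simp add: g_def)
    then have "(p $ 2 - y0) / g \<le> J"
      using pos2 by (simp add: pos_divide_le_eq)
    then show ?thesis unfolding row_def by linarith
  qed
  have row_b: "y0 + row p * g \<le> p $ 2 \<and> p $ 2 < y0 + row p * g + g" if "p \<in> A" for p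
  proof -
    have "real (row p) = of_int \<lfloor>(p $ 2 - y0) / g\<rfloor>"
      using yb[OF that] pos2 by (simp add: row_def)
    then have "real (row p) \<le> (p $ 2 - y0) / g" "(p $ 2 - y0) / g < real (row p) + 1"
      by linarith+
    then show ?thesis using pos2 by (simp add: field_simps)
  qed
  define cell where "cell i r = {p \<in> col i. row p = r}" for i r
  define rich where "rich i = {r. r \<le> J \<and> K \<le> card (cell i r)}" for i
  have cell_le: "real (card (cell i r)) \<le> 9 * \<tau>0 * g / \<delta>^2" if "i \<in> narrow" for i r
  proof (rule card_separated_le_area)
    have i: "i < I" using that by (simp add: narrow_def)
    show "\<delta> \<le> dist p q" if "p \<in> cell i r" "q \<in> cell i r" "p \<noteq> q" for p q
      using that colA[OF i] sep by (auto simp: cell_def)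
    show "X (i * N) \<le> p $ 1 \<and> p $ 1 \<le> X (i * N) + \<tau>0 \<and> y0 + r * g \<le> p $ 2 \<and> p $ 2 \<le> y0 + r * g + g"
      if "p \<in> cell i r" for p
      using that colA[OF i] row_b[of p] colx[OF i, of p] \<open>i \<in> narrow\<close>
      by (fastforce simp: cell_def narrow_def)
  qed (use \<delta> \<tau> \<tau>g in \<open>auto simp: \<tau>0_def\<close>)
  have finr: "finite (rich i)" for i by (simp add: rich_def)
  \<comment> \<open>Cells with fewer than \<open>K\<close> points hold at most \<open>N / 2\<close>
    points together. The rest lies in rich cells of at most \<open>B\<close> points each, and
    \<open>N / 2 > 6 * B\<close>.\<close>
  have rich7: "7 \<le> card (rich i)" if "i \<in> narrow" for i
  proof -
    have i: "i < I" using that by (simp add: narrow_def)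
    have fcol: "finite (col i)" using colA[OF i] fin finite_subset by blast
    define B where "B = 9 * \<tau>0 * g / \<delta>^2"
    have "col i = (\<Union>r\<in>{..J}. cell i r)"
      using colA[OF i] row_le by (auto simp: cell_def)
    then have "N \<le> (\<Sum>r\<le>J. card (cell i r))"
      using card_UN_le[of "{..J}" "cell i"] col_card[OF i] by simp
    then have "real N \<le> (\<Sum>r\<le>J. real (card (cell i r)))"
      by (metis of_nat_le_iff of_nat_sum)
    also have "\<dots> \<le> (\<Sum>r\<le>J. (if r \<in> rich i then B else 0) + K)"
      using cell_le[OF that] by (intro sum_mono) (auto simp: rich_def B_def add_increasing2)
    also have "\<dots> = card (rich i) * B + (J + 1) * K"
    proof -
      have "{..J} \<inter> rich i = rich i" by (auto simp: rich_def)
      then show ?thesis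
        by (simp add: sum.distrib sum.If_cases Int_def algebra_simps flip: sum.inter_restrict)
    qed
    also have "(J + 1) * K \<le> N / 2"
    proof -
      have "real (2 * K * (J + 1)) \<le> real N" using fat by (simp only: of_nat_le_iff)
      then show ?thesis by (simp add: algebra_simps)
    qed
    finally have "N \<le> 2 * (card (rich i) * B)" by simp
    moreover have "12 * B < N" using colB by (simp add: B_def \<tau>0_def g_def)
    moreover have "B > 0" using pos2 \<delta> by (simp add: B_def)
    ultimately have "6 * B < card (rich i) * B" by linarith
    then have "6 < real (card (rich i))" using \<open>B > 0\<close> by simp
    then show ?thesis by simp
  qed
  have "\<forall>i\<in>narrow. \<exists>a b c. a \<in> rich i \<and> b \<in> rich i \<and> c \<in> rich i \<and> a + 3 \<le> b \<and> b + 3 \<le> c"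
  proof
    fix i assume "i \<in> narrow"
    from three_spread_elements[OF finr rich7[OF this]]
    show "\<exists>a b c. a \<in> rich i \<and> b \<in> rich i \<and> c \<in> rich i \<and> a + 3 \<le> b \<and> b + 3 \<le> c" by blast
  qed
  then obtain lo where "\<forall>i\<in>narrow. \<exists>b c. lo i \<in> rich i \<and> b \<in> rich i \<and> c \<in> rich i \<and> lo i + 3 \<le> b \<and> b + 3 \<le> c"
    unfolding bchoice_iff by blast
  then obtain mid where "\<forall>i\<in>narrow. \<exists>c. lo i \<in> rich i \<and> mid i \<in> rich i \<and> c \<in> rich i \<and> lo i + 3 \<le> mid i \<and> mid i + 3 \<le> c"
    unfolding bchoice_iff by blast
  then obtain hi where lmh: "\<forall>i\<in>narrow. lo i \<in> rich i \<and> mid i \<in> rich i \<and> hi i \<in> rich i \<and>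
      lo i + 3 \<le> mid i \<and> mid i + 3 \<le> hi i"
    unfolding bchoice_iff by blast
  note lmh = bspec[OF lmh]
  define win where "win i = nat \<lfloor>(X (i * N) - x0) / \<omega>\<rfloor>" for i
  define key where "key i = (mid i, win i)" for i
  have X0: "x0 \<le> X (i * N)" if "i < I" for i
    using Xm[of 0 "i * N"] idx[OF that, of 0] by (simp add: x0_def)
  \<comment> \<open>There are at least \<open>I / 2\<close> narrow columns but only
    \<open>(J + 1) * (V + 1)\<close> possible keys.\<close>
  have "\<not> inj_on key narrow"
  proof
    assume "inj_on key narrow"
    moreover have "key ` narrow \<subseteq> {..J} \<times> {..V}"
    proof
      fix z assume "z \<in> key ` narrow"
      then obtain i where i: "i \<in> narrow" "z = key i" by blast
      have "i < I" using i by (simp add: narrow_def)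
      then have "X (i * N) \<le> x0 + E" using XE idx[of i 0] by simp
      then have "X (i * N) - x0 \<le> V * \<omega>"
        using pos by (simp add: \<omega>_def)
      then have "(X (i * N) - x0) / \<omega> \<le> V"
        using pos2 by (simp add: pos_divide_le_eq)
      then have "win i \<le> V" unfolding win_def by linarith
      moreover have "mid i \<le> J" using lmh[OF i(1)] by (simp add: rich_def)
      ultimately show "z \<in> {..J} \<times> {..V}" by (simp add: i key_def)
    qed
    ultimately have "card narrow \<le> card ({..J} \<times> {..V})"
      by (metis card_image card_mono finite_SigmaI finite_atMost)
    then have "card narrow \<le> (J + 1) * (V + 1)" by (simp add: card_cartesian_product)
    with narrow_card have "I \<le> 2 * ((J + 1) * (V + 1))" by linarith
    then show False using pig by simp
  qed
  then obtain i i' where ii: "i \<in> narrow" "i' \<in> narrow" "i < i'" "key i = key i'"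
    unfolding inj_on_def by (metis nat_neq_iff)
  then have iI: "i < I" "i' < I" by (auto simp: narrow_def)
  \<comment> \<open>The middle cell comes from the right column \<open>i'\<close>, so that
    \<open>m\<close> lies weakly to the right of both \<open>l\<close> and \<open>u\<close>.\<close>
  define Ls Us Ms Cs where "Ls = cell i (lo i)" and "Us = cell i (hi i)" and "Ms = cell i' (mid i')"
    and "Cs = h ` {n - K..<n}"
  have sub: "Ls \<subseteq> A" "Us \<subseteq> A" "Ms \<subseteq> A" "Cs \<subseteq> A"
    using colA iI hA by (auto simp: Ls_def Us_def Ms_def Cs_def cell_def)
  have big: "K \<le> card Ls" "K \<le> card Us" "K \<le> card Ms"
    using lmh ii by (auto simp: Ls_def Us_def Ms_def rich_def)
  have Ccard: "card Cs = K"
    unfolding Cs_def using inj K4 by (subst card_image) (auto intro: inj_on_subset)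
  \<comment> \<open>Otherwise the at least \<open>n / 4\<close> points between the columns and the
    last \<open>K\<close> points would fit into a box of width \<open>\<Delta>\<close> and height
    \<open>E\<close>, against the packing bound.\<close>
  have gapx: "X (n - K) > X (I * N) + \<Delta>"
  proof (rule ccontr)
    assume *: "\<not> ?thesis"
    define S where "S = h ` {I * N..<n - K}"
    have "card S = n - K - I * N"
    proof -
      have "inj_on h {I * N..<n - K}" by (rule inj_on_subset[OF inj]) auto
      then show ?thesis by (simp add: S_def card_image)
    qed
    then have "real n / 4 \<le> card S" using IN K4 by linarith
    also have "real (card S) \<le> 9 * \<Delta> * E / \<delta>^2"
    proof (rule card_separated_le_area)
      have SA: "S \<subseteq> A" using hA by (auto simp: S_def)
      then show "\<delta> \<le> dist p q" if "p \<in> S" "q \<in> S" "p \<noteq> q" for p q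
        using that sep by auto
      show "X (I * N) \<le> p $ 1 \<and> p $ 1 \<le> X (I * N) + \<Delta> \<and> y0 \<le> p $ 2 \<and> p $ 2 \<le> y0 + E" if p: "p \<in> S" for p
      proof -
        obtain k where k: "p = h k" "I * N \<le> k" "k < n - K" using p by (auto simp: S_def)
        have "X (I * N) \<le> X k" "X k \<le> X (n - K)" using k n0 pos by (auto intro!: Xm)
        then show ?thesis using * k yb[of p] SA p by (auto simp: X_def)
      qed
    qed (use \<delta> gap E\<delta> in \<open>auto simp: \<Delta>_def\<close>)
    finally show False using gap(1) by (simp add: \<Delta>_def)
  qed
  have "inside l c u m" if "l \<in> Ls" "c \<in> Cs" "u \<in> Us" "m \<in> Ms" for l c u m
  proof (rule inside_of_columns)
    have mem: "l \<in> A" "c \<in> A" "u \<in> A" "m \<in> A" using sub that by auto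
    have rows: "row l = lo i" "row u = hi i" "row m = mid i"
      using that ii(4) by (auto simp: Ls_def Us_def Ms_def cell_def key_def)
    have l3: "real (lo i) + 3 \<le> mid i" "real (mid i) + 3 \<le> hi i"
      using lmh[OF ii(1)] by auto
    \<comment> \<open>Row numbers differing by 3 leave two full strips in between, hence a vertical
      gap above \<open>2 * g\<close>.\<close>
    have "(real (lo i) + 3) * g \<le> mid i * g" "(real (mid i) + 3) * g \<le> hi i * g"
      using l3 pos2 by (auto intro!: mult_right_mono)
    then show y: "m $ 2 + 2 * g < u $ 2" "l $ 2 + 2 * g < m $ 2"
      using row_b[OF mem(1)] row_b[OF mem(3)] row_b[OF mem(4)] rows
      by (auto simp: algebra_simps)
    then have "distinct [u, l, m]" using pos2 by auto
    then show "\<not> collinear {u, l, m}"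
      using gp mem unfolding general_position_def by auto
    have cols: "l \<in> col i" "u \<in> col i" "m \<in> col i'"
      using that by (auto simp: Ls_def Us_def Ms_def cell_def)
    have "(i + 1) * N \<le> i' * N" using ii by (intro mult_right_mono) auto
    then have XX: "X ((i + 1) * N) \<le> X (i' * N)" using idx[OF iI(2), of 0] by (intro Xm) auto
    show "l $ 1 \<le> m $ 1" "u $ 1 \<le> m $ 1"
      using colx[OF iI(1) cols(1)] colx[OF iI(1) cols(2)] colx[OF iI(2) cols(3)] XX by auto
    \<comment> \<open>Left ends in one window differ by less than \<open>\<omega>\<close>, and the
      width of the narrow column \<open>i'\<close> adds at most
      \<open>\<tau>0 \<le> \<omega>\<close>: this is the \<open>2 * \<omega>\<close> below.\<close>
    have "win i = win i'" using ii by (simp add: key_def)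
    then have "\<lfloor>(X (i * N) - x0) / \<omega>\<rfloor> = \<lfloor>(X (i' * N) - x0) / \<omega>\<rfloor>"
      using X0[OF iI(1)] X0[OF iI(2)] pos2 unfolding win_def
      by (subst (asm) eq_nat_nat_iff) auto
    then have "\<bar>(X (i * N) - x0) - (X (i' * N) - x0)\<bar> < \<omega>"
      by (rule floor_div_eq_imp_diff_less) (rule pos2)
    moreover have "X ((i' + 1) * N) \<le> X (i' * N) + \<tau>0"
      using ii(2) by (simp add: narrow_def)
    ultimately show "m $ 1 \<le> l $ 1 + 2 * \<omega>" "m $ 1 \<le> u $ 1 + 2 * \<omega>"
      using colx[OF iI(1) cols(1)] colx[OF iI(1) cols(2)] colx[OF iI(2) cols(3)] \<tau>\<omega> by auto
    obtain k where k: "c = h k" "n - K \<le> k" "k < n"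
      using \<open>c \<in> Cs\<close> by (auto simp: Cs_def)
    have "X (n - K) \<le> c $ 1" using Xm[OF k(2,3)] k by (simp add: X_def)
    moreover have "X ((i + 1) * N) \<le> X (I * N)"
      using iI INn by (intro Xm mult_right_mono) auto
    ultimately show "c $ 1 \<ge> l $ 1 + \<Delta>" "c $ 1 \<ge> u $ 1 + \<Delta>"
      using gapx colx[OF iI(1) cols(1)] colx[OF iI(1) cols(2)] by auto
    show "\<bar>c $ 2 - u $ 2\<bar> \<le> E" "\<bar>c $ 2 - l $ 2\<bar> \<le> E"
      using component_diff_le_dist[of c 2] diam mem order_trans by blast+
  qed (use pos2 slope in auto)
  then have "nested Ls Cs Us Ms" by (auto simp: nested_def)
  moreover obtain X' where "X' \<subseteq> Ls" "card X' = K" using big obtain_subset_with_card_n by metis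
  moreover obtain Z' where "Z' \<subseteq> Us" "card Z' = K" using big obtain_subset_with_card_n by metis
  moreover obtain W' where "W' \<subseteq> Ms" "card W' = K" using big obtain_subset_with_card_n by metis
  ultimately have "nested X' Cs Z' W'" "X' \<subseteq> A" "Z' \<subseteq> A" "W' \<subseteq> A" "card X' = K" "card Z' = K" "card W' = K"
    using sub unfolding nested_def by blast+
  then show ?thesis using Ccard sub by blast
qed

text \<open>With \<open>T \<approx> \<alpha>\<^sup>2\<close>, the proof uses \<open>O(T)\<close> strips and \<open>O(T\<^sup>3)\<close> columns, hence clusters of size
  about \<open>n / T\<^sup>4\<close>. The threshold on \<open>n\<close> keeps the average column width above the minimum
  distance, so that the packing bound by area applies.\<close>

lemma large_decomposition:
  fixes A :: "point set" and E \<delta> :: real and T :: nat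
  defines "n \<equiv> card A"
  assumes fin: "finite A" and gp: "general_position A"
    and sep: "\<And>p q. p \<in> A \<Longrightarrow> q \<in> A \<Longrightarrow> p \<noteq> q \<Longrightarrow> \<delta> \<le> dist p q"
    and diam: "\<And>p q. p \<in> A \<Longrightarrow> q \<in> A \<Longrightarrow> dist p q \<le> E"
    and \<delta>: "\<delta> > 0" and E: "E^2 \<le> T * \<delta>^2 * n" "\<delta> * sqrt n / 2 \<le> E"
    and T: "T \<ge> 1" and large: "10^16 * T^6 \<le> n"
  shows "\<exists>K P. K \<le> n \<and> n \<le> 2 * 10^12 * T^4 * K \<and>
           partition_on (complete_edges A) P \<and> card P \<le> n - K \<and>
           (\<forall>E\<in>P. plane_graph E \<and> double_star E)"
proof -
  \<comment> \<open>\<open>J\<close> makes the constant in \<open>colB\<close> 216 / 1000 < 1 / 4.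
    \<open>V\<close> gives \<open>J / V = 1 / (40 * T)\<close>, so the constant in
    \<open>gap1\<close> is 9 / 40 < 1 / 4. \<open>I\<close> exceeds
    \<open>2 * (J + 1) * (V + 1)\<close>, and its square is the threshold in
    \<open>large\<close>.\<close>
  define J V I where "J = 1000 * T" and "V = 40000 * T^2" and "I = 10^8 * T^3"
  define N where "N = n div (2 * I)"
  define K where "K = N div (2 * (J + 1))"
  have T1: "1 \<le> T^2" "1 \<le> T^3" "T \<le> T^2" "T \<le> T^3" "T^2 \<le> T^3"
    using T by (simp_all add: self_le_power power_increasing)
  have I0: "I > 0" using T by (simp add: I_def)
  have II: "I * I \<le> n"
    using large by (simp add: I_def power_mult_distrib flip: power_add)
  have N_lb: "I \<le> 2 * N"
  proof -
    have "I div 2 = (I * I) div (2 * I)" using I0 by simp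
    also have "\<dots> \<le> N" unfolding N_def using II by (rule div_le_mono)
    finally have "I div 2 \<le> N" .
    moreover have "even I" by (simp add: I_def)
    ultimately show ?thesis by auto
  qed
  have N_big: "4 * (J + 1) \<le> N" and N0: "N > 0"
    using N_lb T1 T by (auto simp: I_def J_def)
  have IN: "2 * I * N \<le> n" by (simp add: N_def)
  \<comment> \<open>Rounding down to a positive quotient loses at most a factor 2, here and again
    for \<open>K\<close>. Together \<open>n \<le> 16 * I * (J + 1) * K\<close>, which is the source
    of \<open>2 * 10^12\<close>.\<close>
  have nN: "n \<le> 4 * I * N"
  proof -
    have "n < 2 * I * N + 2 * I"
      unfolding N_def using I0 dividend_less_times_div[of "2 * I" n] by simp
    also have "\<dots> \<le> 2 * I * N + 2 * I * N" using N0 by simp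
    finally show ?thesis by simp
  qed
  have KN: "2 * K * (J + 1) \<le> N"
    unfolding K_def by (metis div_times_less_eq_dividend mult.assoc mult.commute)
  have NK: "N < 2 * (J + 1) * K + 2 * (J + 1)"
    unfolding K_def using dividend_less_times_div[of "2 * (J + 1)" N] by simp
  have K0: "K > 0"
    using N_big NK by (cases K) auto
  have NK': "N \<le> 4 * (J + 1) * K"
  proof -
    have "2 * (J + 1) * 1 \<le> 2 * (J + 1) * K" using K0 by (intro mult_le_mono2) simp
    with NK show ?thesis by linarith
  qed
  have nK: "n \<le> 2 * 10^12 * T^4 * K"
  proof -
    have "n \<le> 4 * I * (4 * (J + 1) * K)"
      using nN NK' by (meson le_trans mult_le_mono2)
    also have "\<dots> = 16 * I * (J + 1) * K" by (simp add: algebra_simps)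
    also have "\<dots> \<le> 16 * I * (1001 * T) * K"
      using T by (intro mult_le_mono) (auto simp: J_def)
    also have "\<dots> = (16 * 1001 * 10^8) * T^4 * K"
      by (simp add: I_def power_numeral_reduce)
    also have "\<dots> \<le> 2 * 10^12 * T^4 * K"
      by (intro mult_le_mono1) simp
    finally show ?thesis .
  qed
  have K4: "4 * K \<le> n"
  proof -
    have "2 * K * 1 \<le> 2 * K * (J + 1)" by (intro mult_le_mono2) simp
    then have "4 * K \<le> 2 * N" using KN by linarith
    also have "\<dots> \<le> 2 * I * N" using I0 by simp
    finally show ?thesis using IN by simp
  qed
  have Ir: "real I = 10^8 * real T^3" and Jr: "real J = 1000 * real T" and Vr: "real V = 40000 * real T^2"
    by (simp_all add: I_def J_def V_def)
  have E\<delta>: "E^2 / \<delta>^2 \<le> T * n" using E(1) \<delta> by (simp add: field_simps)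
  have n0: "real n > 0" using K4 K0 by simp
  have colB: "12 * (9 * (2 * E / I) * (E / J) / \<delta>^2) < N"
  proof -
    have "12 * (9 * (2 * E / I) * (E / J) / \<delta>^2) = 216 * (E^2 / \<delta>^2) / (I * J)"
      by (simp add: power2_eq_square)
    also have "\<dots> \<le> 216 * (T * n) / (I * J)"
      using E\<delta> by (intro divide_right_mono) auto
    also have "\<dots> = 216 / 1000 * n / I"
      using T by (simp add: Jr)
    also have "\<dots> < n / (4 * I)"
      using n0 I0 by (simp add: field_simps)
    also have "\<dots> \<le> N"
    proof -
      have "real n \<le> real (4 * I * N)" using nN by (simp only: of_nat_le_iff)
      then show ?thesis using I0 by (simp add: field_simps)
    qed
    finally show ?thesis .
  qed
  \<comment> \<open>\<open>I\<close> is at most \<open>sqrt n\<close>, and \<open>E\<close> is at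
    least \<open>\<delta> * sqrt n / 2\<close>.\<close>
  have EI: "\<delta> * I \<le> 2 * E"
  proof -
    have "real (I * I) \<le> real n" using II by (simp only: of_nat_le_iff)
    then have "real I \<le> sqrt n" by (intro real_le_rsqrt) (simp add: power2_eq_square)
    then have "\<delta> * I \<le> \<delta> * sqrt n" using \<delta> by simp
    then show ?thesis using E(2) by simp
  qed
  have gap1: "9 * (J * E / V) * E / \<delta>^2 < n / 4"
  proof -
    have "9 * (J * E / V) * E / \<delta>^2 = 9 / (40 * T) * (E^2 / \<delta>^2)"
      using T by (simp add: Jr Vr power2_eq_square)
    also have "\<dots> \<le> 9 / (40 * T) * (T * n)"
      using E\<delta> by (intro mult_left_mono) auto
    also have "\<dots> < n / 4" using T n0 by simp
    finally show ?thesis .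
  qed
  have gap2: "\<delta> \<le> J * E / V"
  proof -
    have "real (80 * T) \<le> real I" using T1 by (simp only: of_nat_le_iff) (simp add: I_def)
    then have "\<delta> * (80 * T) \<le> \<delta> * I" using \<delta> by simp
    with EI have "\<delta> * (40 * T) \<le> E" by simp
    moreover have "J * E / V = E / (40 * T)" using T by (simp add: Jr Vr power2_eq_square)
    ultimately show ?thesis using T by (simp add: pos_le_divide_eq)
  qed
  have pig: "2 * (J + 1) * (V + 1) < I"
  proof -
    have "2 * (J + 1) * (V + 1) \<le> 2 * (1001 * T) * (40001 * T^2)"
      using T T1 by (intro mult_le_mono) (auto simp: J_def V_def)
    also have "\<dots> < I" using T by (simp add: I_def power_numeral_reduce)
    finally show ?thesis .
  qed
  have VI: "2 * V \<le> I" "2 * J \<le> I"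
    using T1 by (simp_all add: I_def V_def J_def)
  have "2 * E / I \<ge> \<delta>" using EI I0 by (simp add: pos_le_divide_eq)
  moreover have "J > 0" "V > 0" using T by (simp_all add: J_def V_def)
  ultimately obtain X Y Z W where "X \<subseteq> A" "Y \<subseteq> A" "Z \<subseteq> A" "W \<subseteq> A" "nested X Y Z W"
      "card X = K" "card Y = K" "card Z = K" "card W = K"
    using clusters_exist[OF fin gp sep diam \<delta> _ _ K0 N0 IN[unfolded n_def] K4[unfolded n_def] KN colB _
        VI gap1[unfolded n_def] gap2 pig] by blast
  from nested_decomposition[OF fin this K0]
  obtain P where "partition_on (complete_edges A) P" "card P \<le> n - K"
      "\<forall>E\<in>P. plane_graph E \<and> double_star E"
    unfolding n_def by blast
  moreover have "K \<le> n" using K4 by simp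
  ultimately show ?thesis using nK by blast
qed

section \<open>From density to the final constant\<close>

text \<open>The witness is the minimum distance. The distance set is finite and nonempty, so
  \<open>Max\<close> and \<open>Min\<close> are genuine and the ratio bound can be multiplied
  out.\<close>

lemma dense_set_bounds:
  assumes "dense_set \<alpha> A"
  obtains \<delta> where "\<delta> > 0" "\<And>p q. p \<in> A \<Longrightarrow> q \<in> A \<Longrightarrow> p \<noteq> q \<Longrightarrow> \<delta> \<le> dist p q"
    "\<And>p q. p \<in> A \<Longrightarrow> q \<in> A \<Longrightarrow> p \<noteq> q \<Longrightarrow> dist p q \<le> \<alpha> * \<delta> * sqrt (card A)"
proof -
  define D where "D = pairwise_dists A"
  have A: "finite A" "card A \<ge> 2" "Max D / Min D \<le> \<alpha> * sqrt (card A)"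
    using assms by (auto simp: dense_set_def dist_ratio_def D_def)
  have "D \<subseteq> (\<lambda>(p, q). dist p q) ` (A \<times> A)"
    by (auto simp: D_def pairwise_dists_def)
  then have finD: "finite D" using A(1) finite_subset by blast
  have mem: "dist p q \<in> D" if "p \<in> A" "q \<in> A" "p \<noteq> q" for p q
    using that by (auto simp: D_def pairwise_dists_def)
  obtain p q where "p \<in> A" "q \<in> A" "p \<noteq> q"
    using A(2) by (auto simp: numeral_2_eq_2 card_le_Suc_iff)
  then have "D \<noteq> {}" using mem by blast
  with finD have "Min D \<in> D" by simp
  then have pos: "Min D > 0" by (auto simp: D_def pairwise_dists_def)
  show ?thesis
  proof
    show "Min D > 0" by (rule pos)
    show "Min D \<le> dist p q" if "p \<in> A" "q \<in> A" "p \<noteq> q" for p q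
      using mem[OF that] finD by simp
    show "dist p q \<le> \<alpha> * Min D * sqrt (card A)" if "p \<in> A" "q \<in> A" "p \<noteq> q" for p q
    proof -
      have "dist p q \<le> Max D" using mem[OF that] finD by simp
      also have "\<dots> \<le> \<alpha> * sqrt (card A) * Min D"
        using A(3) pos by (simp add: pos_divide_le_eq)
      finally show ?thesis by (simp add: mult_ac)
    qed
  qed
qed

text \<open>The first two factors are at least 1, and \<open>pi < 4\<close> bounds the
  third.\<close>

lemma alpha0_ge_half: "1 / 2 \<le> 2 powr (1/2) * 3 powr (1/4) * pi powr (-1/2)"
proof -
  have "(1::real) \<le> 2 powr (1/2)" "(1::real) \<le> 3 powr (1/4)"
    by (simp_all add: ge_one_powr_ge_zero)
  then have "1 * 1 \<le> (2 powr (1/2) * 3 powr (1/4) :: real)" by (intro mult_mono) auto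
  moreover have "1 / 2 \<le> pi powr (-1/2)"
  proof -
    have "pi powr (1/2) \<le> 4 powr (1/2)" using pi_less_4 by (intro powr_mono2) auto
    also have "\<dots> = 2" by (simp add: powr_half_sqrt)
    finally have "pi powr (1/2) \<le> 2" .
    then show ?thesis using le_imp_inverse_le[of "pi powr (1/2)" 2]
      by (simp add: powr_minus)
  qed
  ultimately have "1 * (1 / 2) \<le> (2 powr (1/2) * 3 powr (1/4)) * pi powr (-1/2)"
    by (intro mult_mono) auto
  then show ?thesis by simp
qed

text \<open>The exponent 12 comes from small sets: below the threshold of order \<open>T^6\<close>,
  hence of order \<open>\<alpha>^12\<close>, saving one part is enough. Above it the saving is of
  order \<open>n / T^4\<close>, which is weakened to the same form.\<close>

lemma dense_decomposition:
  assumes \<alpha>: "\<alpha> \<ge> 1 / 2" and dense: "dense_set \<alpha> A" and gp: "general_position A"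
  shows "\<exists>P. partition_on (complete_edges A) P \<and>
           card P \<le> (1 - 1 / 10^21 / \<alpha>^12) * card A \<and>
           (\<forall>E\<in>P. plane_graph E \<and> double_star E)"
proof -
  define n where "n = card A"
  have fin: "finite A" and n2: "n \<ge> 2" using dense by (auto simp: dense_set_def n_def)
  define T where "T = nat \<lceil>\<alpha>^2\<rceil>"
  have \<alpha>2: "1 / 4 \<le> \<alpha>^2" using power_mono[OF \<alpha>, of 2] by (simp add: power2_eq_square)
  \<comment> \<open>Rounding up adds at most 1, which is at most \<open>4 * \<alpha>^2\<close>
    because \<open>\<alpha>^2 \<ge> 1 / 4\<close>. The sixth power of 5 is the 15625 below.\<close>
  have T: "\<alpha>^2 \<le> T" "T \<le> 5 * \<alpha>^2" "T \<ge> 1" using \<alpha>2 unfolding T_def by linarith+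
  have "real T^6 \<le> (5 * \<alpha>^2)^6" using T by (intro power_mono) auto
  then have T6: "real T^6 \<le> 15625 * \<alpha>^12" by (simp add: power_mult_distrib flip: power_mult)
  have \<alpha>12: "\<alpha>^12 > 0" using \<alpha> by simp
  show ?thesis
  proof (cases "10^16 * T^6 \<le> n")
    case True
    obtain \<delta> where \<delta>: "\<delta> > 0" "\<And>p q. p \<in> A \<Longrightarrow> q \<in> A \<Longrightarrow> p \<noteq> q \<Longrightarrow> \<delta> \<le> dist p q"
      "\<And>p q. p \<in> A \<Longrightarrow> q \<in> A \<Longrightarrow> p \<noteq> q \<Longrightarrow> dist p q \<le> \<alpha> * \<delta> * sqrt (card A)"
      using dense_set_bounds[OF dense] by metis
    define E where "E = \<alpha> * \<delta> * sqrt n"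
    have diam: "dist p q \<le> E" if "p \<in> A" "q \<in> A" for p q
      using \<delta>(1) \<delta>(3)[OF that] \<alpha> by (cases "p = q") (auto simp: E_def n_def)
    have "E^2 = \<alpha>^2 * (\<delta>^2 * n)" by (simp add: E_def power_mult_distrib)
    also have "\<dots> \<le> T * (\<delta>^2 * n)" using T by (intro mult_right_mono) auto
    finally have E1: "E^2 \<le> T * \<delta>^2 * n" by simp
    have "1 / 2 * (\<delta> * sqrt n) \<le> \<alpha> * (\<delta> * sqrt n)"
      using \<alpha> \<delta> by (intro mult_right_mono) auto
    then have E2: "\<delta> * sqrt n / 2 \<le> E" by (simp add: E_def mult_ac)
    obtain K P where K: "K \<le> n" "n \<le> 2 * 10^12 * T^4 * K" and
      P: "partition_on (complete_edges A) P" "card P \<le> n - K" "\<forall>E\<in>P. plane_graph E \<and> double_star E"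
      using large_decomposition[OF fin gp \<delta>(2) diam \<delta>(1) E1[unfolded n_def] E2[unfolded n_def] T(3)
          True[unfolded n_def]] unfolding n_def by blast
    have "real n \<le> real (2 * 10^12 * T^4 * K)" using K(2) by (simp only: of_nat_le_iff)
    then have "real n \<le> 2 * 10^12 * real T^4 * K" by simp
    also have "\<dots> \<le> 2 * 10^12 * real T^6 * K"
      using T by (intro mult_mono power_increasing) auto
    also have "\<dots> \<le> 2 * 10^12 * (15625 * \<alpha>^12) * K"
      using T6 by (intro mult_right_mono mult_left_mono) auto
    also have "\<dots> \<le> 10^21 * \<alpha>^12 * K"
      using \<alpha>12 by simp
    finally have "1 / 10^21 / \<alpha>^12 * n \<le> K"
      using \<alpha>12 by (simp add: field_simps)
    moreover have "real (card P) \<le> n - real K" using P(2) K(1) by linarith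
    ultimately have "card P \<le> (1 - 1 / 10^21 / \<alpha>^12) * n" by (simp add: algebra_simps)
    then show ?thesis using P unfolding n_def by blast
  next
    case False
    then have "real n \<le> real (10^16 * T^6)" by (simp only: of_nat_le_iff)
    then have "real n \<le> 10^16 * real T^6" by simp
    also have "\<dots> \<le> 10^16 * (15625 * \<alpha>^12)" using T6 by simp
    also have "\<dots> \<le> 10^21 * \<alpha>^12" using \<alpha>12 by simp
    finally have "1 / 10^21 / \<alpha>^12 * n \<le> 1"
      using \<alpha>12 by (simp add: field_simps)
    moreover obtain P where P: "partition_on (complete_edges A) P" "card P \<le> n - 1"
        "\<forall>E\<in>P. plane_graph E \<and> double_star E"
      using trivial_decomposition[OF fin] n2 unfolding n_def by fastforce
    moreover have "real (card P) \<le> real n - 1" using P(2) n2 by linarith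
    ultimately have "card P \<le> (1 - 1 / 10^21 / \<alpha>^12) * n" by (simp add: algebra_simps)
    then show ?thesis using P unfolding n_def by blast
  qed
qed

theorem theorem1:
  "\<exists>\<gamma>::real. \<gamma> > 0 \<and>
     (\<exists>c :: real \<Rightarrow> real.
        \<forall>\<alpha>::real. \<alpha> \<ge> 2 powr (1/2) * 3 powr (1/4) * pi powr (-1/2) \<longrightarrow>
          c \<alpha> < 1 \<and> c \<alpha> \<le> 1 - \<gamma> * \<alpha> powi (-12) \<and>
          (\<forall>A :: point set. dense_set \<alpha> A \<and> general_position A \<longrightarrow>
             (\<exists>P. partition_on (complete_edges A) P \<and>
                  real (card P) \<le> c \<alpha> * real (card A) \<and>
                  (\<forall>E\<in>P. plane_graph E \<and>
                     (star E \<or> (\<exists>S T. star S \<and> star T \<and> E = S \<union> T))))))"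
\<comment> \<open>\<open>c\<close> is taken to be the required upper bound itself, so the second
  inequality holds with equality.\<close>
proof (intro exI[of _ "1 / 10^21 :: real"] exI[of _ "\<lambda>\<alpha>::real. 1 - 1 / 10^21 / \<alpha>^12"]
    conjI allI impI)
  show "0 < (1 / 10^21 :: real)" by simp
  fix \<alpha> :: real
  assume "2 powr (1/2) * 3 powr (1/4) * pi powr (-1/2) \<le> \<alpha>"
  then have \<alpha>: "1 / 2 \<le> \<alpha>" using alpha0_ge_half by linarith
  then show "1 - 1 / 10^21 / \<alpha>^12 < 1" by simp
  show "1 - 1 / 10^21 / \<alpha>^12 \<le> 1 - 1 / 10^21 * \<alpha> powi (-12)"
  proof -
    have "\<alpha> powi (-12) = inverse (\<alpha>^12)"
      by (simp only: power_int_minus power_int_numeral)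
    then have "1 / 10^21 * \<alpha> powi (-12) = 1 / 10^21 / \<alpha>^12"
      by (simp only: divide_inverse)
    then show ?thesis by (simp only: order_refl)
  qed
  fix A assume "dense_set \<alpha> A \<and> general_position A"
  then obtain P where "partition_on (complete_edges A) P"
    "real (card P) \<le> (1 - 1 / 10^21 / \<alpha>^12) * real (card A)"
    "\<forall>E\<in>P. plane_graph E \<and> double_star E"
    using dense_decomposition[OF \<alpha>] by blast
  then show "\<exists>P. partition_on (complete_edges A) P \<and>
                  real (card P) \<le> (1 - 1 / 10^21 / \<alpha>^12) * real (card A) \<and>
                  (\<forall>E\<in>P. plane_graph E \<and>
                     (star E \<or> (\<exists>S T. star S \<and> star T \<and> E = S \<union> T)))"
    unfolding double_star_def by blast
qed

end
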